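(* Let $\mathsf L(\mu,\epsilon)$ be a $2\times2$ matrix of the form described in the context, whose entries satisfy the assumptions stated there. Then: (i) The matrix $\mathsf L(\mu,\epsilon)$ has eigenvalues with nonzero real part, for $(\mu,\epsilon)$ close to $(\underline\mu,0)$, if and only if the analytic function $(-\epsilon_1,\epsilon_1)\ni\epsilon\mapsto\beta(\mu_0(\epsilon),\epsilon)$ is not identically zero; equivalently, if and only if there exists $n\in\mathbb N$ such that $\frac{d^n}{d\epsilon^n}\beta(\mu_0(\epsilon),\epsilon)\big|_{\epsilon=0}\neq0$. (ii) The spectrum of $\mathsf L(\mu,\epsilon)$, for $(\mu,\epsilon)$ close to $(\underline\mu,0)$, consists of two eigenvalues $\lambda^\pm(\mu,\epsilon)$ with opposite nonzero real part if and only if $(\mu,\epsilon)$ lies inside the region $$R:=\{(\mu,\epsilon)\in B_{\delta_0}(\underline\mu)\times B_{\epsilon_1}(0): D(\mu,\epsilon)=-d_+(\mu,\epsilon)\,d_-(\mu,\epsilon)>0\}=\{(\mu,\epsilon)\in B_{\delta_0}(\underline\mu)\times B_{\epsilon_1}(0):\mu_\wedge(\epsilon)<\mu<\mu_\vee(\epsilon)\},$$ whereas, for $(\mu,\epsilon)\notin R$, the eigenvalues $\lambda^\pm(\mu,\epsilon)$ are purely imaginary.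
   Context: **The matrix.** $B_\delta(x)=(x-\delta,x+\delta)\subset\mathbb R$. Let $\underline\mu\in\mathbb R$, and $$\mathsf L(\mu,\epsilon)=\mathsf J\,\mathsf B(\mu,\epsilon),\quad \mathsf J=\begin{pmatrix}-\mathrm i&0\\0&\mathrm i\end{pmatrix},\quad \mathsf B(\mu,\epsilon)=\begin{pmatrix}\alpha(\mu,\epsilon)&\mathrm i\beta(\mu,\epsilon)\\-\mathrm i\beta(\mu,\epsilon)&\gamma(\mu,\epsilon)\end{pmatrix},$$ with $\alpha,\beta,\gamma$ real analytic functions on $B_{\delta_0}(\underline\mu)\times B_{\epsilon_0}(0)$. **Assumptions.** For $(\mu,\epsilon)=(\underline\mu+\delta,\epsilon)\in B_{\delta_0}(\underline\mu)\times B_{\epsilon_0}(0)$, with real constants $\alpha_i,\beta_i,\gamma_i$, $$\alpha(\underline\mu+\delta,\epsilon)=-\alpha_0(\delta)+\alpha_2\epsilon^2+r(\epsilon^3,\delta\epsilon^2,\delta^2\epsilon),$$ $$\beta(\underline\mu+\delta,\epsilon)=\beta_1\epsilon^2+\beta_2\delta\epsilon^2+\beta_3\epsilon^4+r(\epsilon^5,\delta\epsilon^3,\delta^2\epsilon^2,\delta^3\epsilon),$$ $$\gamma(\underline\mu+\delta,\epsilon)=\gamma_0(\delta)+\gamma_2\epsilon^2+r(\epsilon^3,\delta\epsilon^2,\delta^2\epsilon),$$ where $\alpha_0(\delta)=\omega_*^{(p)}-\alpha_1\delta+r(\delta^2)$, $\gamma_0(\delta)=\omega_*^{(p)}+\gamma_1\delta+r(\delta^2)$,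 $\omega_*^{(p)}=\frac{p^2-1}4$ with $p\ge2$ a fixed integer, and $\alpha_1+\gamma_1>0$. **Derived objects.** $T(\mu,\epsilon):=\alpha(\mu,\epsilon)+\gamma(\mu,\epsilon)$, $d_\pm(\mu,\epsilon):=T(\mu,\epsilon)\pm2\beta(\mu,\epsilon)$, $D(\mu,\epsilon):=4\beta^2(\mu,\epsilon)-T^2(\mu,\epsilon)$. By the analytic implicit function theorem (with $\delta_0$ small enough) there is $\epsilon_1\in(0,\epsilon_0)$ such that the zero sets of $T$, $d_+$, $d_-$ in $B_{\delta_0}(\underline\mu)\times B_{\epsilon_1}(0)$ are the graphs of analytic functions $\mu_0,\mu_+,\mu_-:(-\epsilon_1,\epsilon_1)\to B_{\delta_0}(\underline\mu)$, i.e. $T(\mu_0(\epsilon),\epsilon)\equiv0$ and $d_\pm(\mu_\pm(\epsilon),\epsilon)\equiv0$. Set $\mu_\wedge(\epsilon):=\min\{\mu_+(\epsilon),\mu_-(\epsilon)\}$ and $\mu_\vee(\epsilon):=\max\{\mu_+(\epsilon),\mu_-(\epsilon)\}$. The eigenvalues of $\mathsf L(\mu,\epsilon)$ are denoted $\lambda^\pm(\mu,\epsilon)$. **Remainders.** $r(\delta^{m_1}\epsilon^{n_1},\dots,\delta^{m_q}\epsilon^{n_q})$ denotes a real analytic function, possibly different at each occurrence, with $|r|\le C\sum_{j=1}^q|\delta|^{m_j}|\epsilon|^{n_j}$ for some $C>0$ and all small $(\delta,\epsilon)$. *)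

theory Defs
  imports "HOL-Analysis.Analysis" "Jordan_Normal_Form.Spectral_Radius"
begin

definition real_analytic_on :: "(real \<Rightarrow> real) \<Rightarrow> real set \<Rightarrow> bool" where
  "real_analytic_on f S \<longleftrightarrow>
     (\<forall>x0\<in>S. \<exists>\<rho>>0. \<exists>a :: nat \<Rightarrow> real. \<forall>x\<in>ball x0 \<rho>.
        (\<lambda>n. a n * (x - x0) ^ n) sums f x)"

text \<open>In two variables the local expansion is a double power series; summation over the
  index set of all pairs is unordered, hence absolute.\<close>

definition real_analytic2_on :: "(real \<Rightarrow> real \<Rightarrow> real) \<Rightarrow> (real \<times> real) set \<Rightarrow> bool" where
  "real_analytic2_on f S \<longleftrightarrow>
     (\<forall>(x0, y0)\<in>S. \<exists>\<rho>>0. \<exists>a :: nat \<Rightarrow> nat \<Rightarrow> real. \<forall>x\<in>ball x0 \<rho>. \<forall>y\<in>ball y0 \<rho>.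
        ((\<lambda>(m, n). a m n * (x - x0) ^ m * (y - y0) ^ n) has_sum f x y) UNIV)"

text \<open>A remainder \<open>r(\<delta>\<^sup>m\<^sup>1, \<dots>, \<delta>\<^sup>m\<^sup>q)\<close> is encoded by its list of exponents, and
  \<open>r(\<delta>\<^sup>m\<^sup>1\<epsilon>\<^sup>n\<^sup>1, \<dots>, \<delta>\<^sup>m\<^sup>q\<epsilon>\<^sup>n\<^sup>q)\<close> by its list of pairs of exponents
  (power of \<open>\<delta>\<close>, power of \<open>\<epsilon>\<close>). It is analytic on the whole domain,
  but the bound is only required for small arguments.\<close>

definition remainder1 :: "real set \<Rightarrow> nat list \<Rightarrow> (real \<Rightarrow> real) \<Rightarrow> bool" where
  "remainder1 S ms r \<longleftrightarrow> real_analytic_on r S \<and>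
     (\<exists>C>0. \<forall>\<^sub>F \<delta> in nhds 0. \<bar>r \<delta>\<bar> \<le> C * (\<Sum>m\<leftarrow>ms. \<bar>\<delta>\<bar> ^ m))"

definition remainder2 :: "(real \<times> real) set \<Rightarrow> (nat \<times> nat) list \<Rightarrow> (real \<Rightarrow> real \<Rightarrow> real) \<Rightarrow> bool" where
  "remainder2 S ms r \<longleftrightarrow> real_analytic2_on r S \<and>
     (\<exists>C>0. \<forall>\<^sub>F (\<delta>, \<epsilon>) in nhds (0, 0).
        \<bar>r \<delta> \<epsilon>\<bar> \<le> C * (\<Sum>(m, n)\<leftarrow>ms. \<bar>\<delta>\<bar> ^ m * \<bar>\<epsilon>\<bar> ^ n))"

definition J_mat :: "complex mat" where
  "J_mat = mat_of_rows_list 2 [[- \<i>, 0], [0, \<i>]]"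

definition B_mat ::
  "(real \<Rightarrow> real \<Rightarrow> real) \<Rightarrow> (real \<Rightarrow> real \<Rightarrow> real) \<Rightarrow> (real \<Rightarrow> real \<Rightarrow> real) \<Rightarrow> real \<Rightarrow> real \<Rightarrow> complex mat" where
  "B_mat \<alpha> \<beta> \<gamma> \<mu> \<epsilon> = mat_of_rows_list 2
     [[of_real (\<alpha> \<mu> \<epsilon>), \<i> * of_real (\<beta> \<mu> \<epsilon>)],
      [- \<i> * of_real (\<beta> \<mu> \<epsilon>), of_real (\<gamma> \<mu> \<epsilon>)]]"

definition L_mat ::
  "(real \<Rightarrow> real \<Rightarrow> real) \<Rightarrow> (real \<Rightarrow> real \<Rightarrow> real) \<Rightarrow> (real \<Rightarrow> real \<Rightarrow> real) \<Rightarrow> real \<Rightarrow> real \<Rightarrow> complex mat" where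
  "L_mat \<alpha> \<beta> \<gamma> \<mu> \<epsilon> = J_mat * B_mat \<alpha> \<beta> \<gamma> \<mu> \<epsilon>"

definition T_fun ::
  "(real \<Rightarrow> real \<Rightarrow> real) \<Rightarrow> (real \<Rightarrow> real \<Rightarrow> real) \<Rightarrow> real \<Rightarrow> real \<Rightarrow> real" where
  "T_fun \<alpha> \<gamma> \<mu> \<epsilon> = \<alpha> \<mu> \<epsilon> + \<gamma> \<mu> \<epsilon>"

definition d_plus ::
  "(real \<Rightarrow> real \<Rightarrow> real) \<Rightarrow> (real \<Rightarrow> real \<Rightarrow> real) \<Rightarrow> (real \<Rightarrow> real \<Rightarrow> real) \<Rightarrow> real \<Rightarrow> real \<Rightarrow> real" where
  "d_plus \<alpha> \<beta> \<gamma> \<mu> \<epsilon> = T_fun \<alpha> \<gamma> \<mu> \<epsilon> + 2 * \<beta> \<mu> \<epsilon>"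

definition d_minus ::
  "(real \<Rightarrow> real \<Rightarrow> real) \<Rightarrow> (real \<Rightarrow> real \<Rightarrow> real) \<Rightarrow> (real \<Rightarrow> real \<Rightarrow> real) \<Rightarrow> real \<Rightarrow> real \<Rightarrow> real" where
  "d_minus \<alpha> \<beta> \<gamma> \<mu> \<epsilon> = T_fun \<alpha> \<gamma> \<mu> \<epsilon> - 2 * \<beta> \<mu> \<epsilon>"

definition D_fun ::
  "(real \<Rightarrow> real \<Rightarrow> real) \<Rightarrow> (real \<Rightarrow> real \<Rightarrow> real) \<Rightarrow> (real \<Rightarrow> real \<Rightarrow> real) \<Rightarrow> real \<Rightarrow> real \<Rightarrow> real" where
  "D_fun \<alpha> \<beta> \<gamma> \<mu> \<epsilon> = 4 * (\<beta> \<mu> \<epsilon>)\<^sup>2 - (T_fun \<alpha> \<gamma> \<mu> \<epsilon>)\<^sup>2"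

definition R_region ::
  "(real \<Rightarrow> real \<Rightarrow> real) \<Rightarrow> (real \<Rightarrow> real \<Rightarrow> real) \<Rightarrow> (real \<Rightarrow> real \<Rightarrow> real) \<Rightarrow> (real \<times> real) set \<Rightarrow> (real \<times> real) set" where
  "R_region \<alpha> \<beta> \<gamma> S = {(\<mu>, \<epsilon>) \<in> S. D_fun \<alpha> \<beta> \<gamma> \<mu> \<epsilon> > 0}"

text \<open>The parameter \<open>\<mu>\<close> is the first coordinate, so the zero set is a graph over the second
  coordinate.\<close>

definition zero_set_is_analytic_graph ::
  "(real \<Rightarrow> real \<Rightarrow> real) \<Rightarrow> real set \<Rightarrow> real set \<Rightarrow> (real \<Rightarrow> real) \<Rightarrow> bool" where
  "zero_set_is_analytic_graph f U V g \<longleftrightarrow>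
     real_analytic_on g V \<and> g \<in> V \<rightarrow> U \<and>
     {(\<mu>, \<epsilon>) \<in> U \<times> V. f \<mu> \<epsilon> = 0} = {(\<mu>, \<epsilon>). \<epsilon> \<in> V \<and> \<mu> = g \<epsilon>}"

end

theory Submission
  imports Defs "HOL-Complex_Analysis.Complex_Analysis"
begin

text \<open>The eigenvalues are \<open>\<lambda> = \<i> (\<gamma> - \<alpha>) / 2 \<plusminus> \<surd>D / 2\<close> with \<open>D = 4 \<beta>\<^sup>2 - T\<^sup>2 = - d\<^sub>+ d\<^sub>-\<close>, so
  they leave the imaginary axis exactly where \<open>D > 0\<close>. On the axis \<open>\<epsilon> = 0\<close> the expansions give
  \<open>d\<^sub>\<plusminus> = (\<alpha>\<^sub>1 + \<gamma>\<^sub>1) \<delta> + O(\<delta>\<^sup>2)\<close>; as each side of the graph of \<open>\<mu>\<^sub>\<plusminus>\<close> is connected and \<open>d\<^sub>\<plusminus>\<close> does not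
  vanish there, \<open>d\<^sub>\<plusminus>\<close> has the sign of \<open>\<mu> - \<mu>\<^sub>\<plusminus>(\<epsilon>)\<close> everywhere, which yields the region between
  the two curves. Along \<open>\<mu> = \<mu>\<^sub>0(\<epsilon>)\<close> one has \<open>D = 4 \<beta>\<^sup>2\<close>, positive arbitrarily close to
  \<open>\<epsilon> = 0\<close> unless the analytic function \<open>\<beta>(\<mu>\<^sub>0(\<epsilon>), \<epsilon>)\<close> vanishes identically, and in that case
  \<open>\<mu>\<^sub>+ = \<mu>\<^sub>- = \<mu>\<^sub>0\<close>, so that the region is empty.\<close>

section \<open>Real analytic functions of one and two variables\<close>

text \<open>A real power series converges on the complex disc of the same radius, and conversely the
  real parts of complex Taylor coefficients expand \<open>f\<close>. This bridge lets closure under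
  composition follow from theorems on holomorphic limits instead of rearranged series.\<close>

lemma real_analytic_on_iff_holomorphic:
  "real_analytic_on f S \<longleftrightarrow>
     (\<forall>x0\<in>S. \<exists>\<rho>>0. \<exists>F. F holomorphic_on ball (complex_of_real x0) \<rho> \<and>
        (\<forall>x\<in>ball x0 \<rho>. F (complex_of_real x) = complex_of_real (f x)))"
proof (intro iffI ballI)
  fix x0 assume "real_analytic_on f S" "x0 \<in> S"
  then obtain \<rho> a where \<rho>: "\<rho> > 0"
    and a: "\<And>x. x \<in> ball x0 \<rho> \<Longrightarrow> (\<lambda>n. a n * (x - x0) ^ n) sums f x"
    unfolding real_analytic_on_def by meson
  define F where "F z = (\<Sum>n. complex_of_real (a n) * (z - of_real x0) ^ n)" for z
  have sums: "(\<lambda>n. complex_of_real (a n) * (z - of_real x0) ^ n) sums F z"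
    if z: "z \<in> ball (complex_of_real x0) \<rho>" for z
  proof -
    \<comment> \<open>Convergence at the real point \<open>x0 + r\<close>, farther from the centre
      than \<open>z\<close>, implies convergence at \<open>z\<close>.\<close>
    obtain r where r: "dist z (of_real x0) < r" "r < \<rho>"
      using z dense by (auto simp: dist_commute)
    have r0: "r > 0" using r(1) zero_le_dist[of z "of_real x0"] by linarith
    have "(\<lambda>n. a n * r ^ n) sums f (x0 + r)"
      using a[of "x0 + r"] r r0 by (simp add: dist_real_def)
    then have "(\<lambda>n. complex_of_real (a n * r ^ n)) sums of_real (f (x0 + r))"
      by (simp only: sums_of_real_iff)
    then have "summable (\<lambda>n. complex_of_real (a n) * (of_real r) ^ n)"
      by (auto simp: sums_iff)
    then have "summable (\<lambda>n. complex_of_real (a n) * (z - of_real x0) ^ n)"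
      by (rule powser_inside) (use r r0 in \<open>simp add: dist_norm\<close>)
    then show ?thesis unfolding F_def by (rule summable_sums)
  qed
  have "F (of_real x) = of_real (f x)" if x: "x \<in> ball x0 \<rho>" for x
  proof -
    have "(\<lambda>n. complex_of_real (a n) * (of_real x - of_real x0) ^ n) sums of_real (f x)"
      using a[OF x, THEN sums_of_real[where 'a = complex]] by simp
    moreover have "complex_of_real x \<in> ball (of_real x0) \<rho>"
      using x by (simp add: dist_real_def dist_norm flip: of_real_diff)
    ultimately show ?thesis using sums sums_unique2 by blast
  qed
  then show "\<exists>\<rho>>0. \<exists>F. F holomorphic_on ball (complex_of_real x0) \<rho> \<and>
      (\<forall>x\<in>ball x0 \<rho>. F (of_real x) = of_real (f x))"
    using \<rho> power_series_holomorphic[OF sums] by blast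
next
  assume *: "\<forall>x0\<in>S. \<exists>\<rho>>0. \<exists>F. F holomorphic_on ball (complex_of_real x0) \<rho> \<and>
        (\<forall>x\<in>ball x0 \<rho>. F (complex_of_real x) = complex_of_real (f x))"
  show "real_analytic_on f S"
    unfolding real_analytic_on_def
  proof
    fix x0 assume "x0 \<in> S"
    then obtain \<rho> F where \<rho>: "\<rho> > 0" and hol: "F holomorphic_on ball (complex_of_real x0) \<rho>"
      and F: "\<And>x. x\<in>ball x0 \<rho> \<Longrightarrow> F (complex_of_real x) = complex_of_real (f x)"
      using * by meson
    define c where "c n = (deriv ^^ n) F (of_real x0) / fact n" for n
    \<comment> \<open>On the real axis both \<open>F\<close> and the powers of \<open>x - x0\<close>
      are real, so taking real parts of the Taylor series only affects the coefficients.\<close>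
    have "(\<lambda>n. Re (c n) * (x - x0) ^ n) sums f x" if x: "x \<in> ball x0 \<rho>" for x
    proof -
      have "complex_of_real x \<in> ball (of_real x0) \<rho>"
        using x by (simp add: dist_real_def dist_norm flip: of_real_diff)
      from holomorphic_power_series[OF hol this]
      have "(\<lambda>n. c n * of_real ((x - x0) ^ n)) sums of_real (f x)"
        using F[OF x] by (simp add: c_def)
      from sums_Re[OF this] show ?thesis by simp
    qed
    with \<rho> show "\<exists>\<rho>>0. \<exists>a. \<forall>x\<in>ball x0 \<rho>. (\<lambda>n. a n * (x - x0) ^ n) sums f x"
      by (intro exI[of _ \<rho>] exI[of _ "\<lambda>n. Re (c n)"] conjI ballI)
  qed
qed

text \<open>Weierstrass M-test, the majorant being the absolutely summable family at the corner
  \<open>(r, r)\<close>; for negative \<open>r\<close> the polydisc is empty. The field is kept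
  general because the real case gives continuity and the complex case gives composition.\<close>

lemma double_power_series_uniform_limit:
  fixes a :: "nat \<Rightarrow> nat \<Rightarrow> real"
  assumes "(\<lambda>(m, n). a m n * r ^ m * r ^ n) summable_on UNIV"
  shows "uniform_limit (cball 0 r \<times> cball (0 :: 'a :: {real_normed_field, banach}) r)
           (\<lambda>I (w, z). \<Sum>(m, n)\<in>I. of_real (a m n) * w ^ m * z ^ n)
           (\<lambda>(w, z). \<Sum>\<^sub>\<infinity>(m, n). of_real (a m n) * w ^ m * z ^ n)
           (finite_subsets_at_top UNIV)"
proof (cases "r \<ge> 0")
  case True
  have "norm (case mn of (m, n) \<Rightarrow> of_real (a m n) * fst y ^ m * snd y ^ n)
      \<le> norm (case mn of (m, n) \<Rightarrow> a m n * r ^ m * r ^ n)"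
    if "y \<in> cball 0 r \<times> cball (0 :: 'a) r" for y and mn :: "nat \<times> nat"
    using that True
    by (auto simp: norm_mult norm_power abs_mult power_abs split: prod.splits
          intro!: mult_mono power_mono)
  moreover have "(\<lambda>mn. norm (case mn of (m, n) \<Rightarrow> a m n * r ^ m * r ^ n)) summable_on UNIV"
    using assms summable_on_iff_abs_summable_on_real by blast
  ultimately have "uniform_limit (cball 0 r \<times> cball (0 :: 'a) r)
     (\<lambda>I y. \<Sum>mn\<in>I. case mn of (m, n) \<Rightarrow> of_real (a m n) * fst y ^ m * snd y ^ n)
     (\<lambda>y. \<Sum>\<^sub>\<infinity>mn. case mn of (m, n) \<Rightarrow> of_real (a m n) * fst y ^ m * snd y ^ n)
     (finite_subsets_at_top UNIV)"
    by (rule Weierstrass_m_test_general)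
  then show ?thesis
    by (simp only: case_prod_unfold)
qed simp

text \<open>Halving the radius puts the corner of the closed square inside the domain of the
  expansion, so summability there comes for free as a majorant.\<close>

lemma real_analytic2_onE:
  assumes "real_analytic2_on F S" "(x0, y0) \<in> S"
  obtains r a where "r > 0"
    "\<And>x y. x \<in> cball x0 r \<Longrightarrow> y \<in> cball y0 r \<Longrightarrow>
        ((\<lambda>(m, n). a m n * (x - x0) ^ m * (y - y0) ^ n) has_sum F x y) UNIV"
    "(\<lambda>(m, n). a m n * r ^ m * r ^ n) summable_on UNIV"
proof -
  obtain \<rho> a where \<rho>: "\<rho> > 0"
    and a: "\<And>x y. x \<in> ball x0 \<rho> \<Longrightarrow> y \<in> ball y0 \<rho> \<Longrightarrow>
        ((\<lambda>(m, n). a m n * (x - x0) ^ m * (y - y0) ^ n) has_sum F x y) UNIV"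
    using assms unfolding real_analytic2_on_def by (fastforce simp: split_beta)
  show ?thesis
  proof (rule that[of "\<rho> / 2" a])
    show "(\<lambda>(m, n). a m n * (\<rho> / 2) ^ m * (\<rho> / 2) ^ n) summable_on UNIV"
      using a[of "x0 + \<rho> / 2" "y0 + \<rho> / 2"] \<rho>
      by (auto simp: dist_real_def summable_on_def)
  qed (use \<rho> a in auto)
qed

text \<open>Near each point the function is a uniform limit of polynomials, namely the finite
  partial sums.\<close>

lemma real_analytic2_on_imp_continuous_on:
  assumes "real_analytic2_on F S"
  shows "continuous_on S (\<lambda>(x, y). F x y)"
proof (rule continuous_at_imp_continuous_on, rule ballI)
  fix p assume "p \<in> S"
  obtain x0 y0 where p: "p = (x0, y0)" by force
  obtain r a where r: "r > 0"
    and a: "\<And>x y. x \<in> cball x0 r \<Longrightarrow> y \<in> cball y0 r \<Longrightarrow>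
        ((\<lambda>(m, n). a m n * (x - x0) ^ m * (y - y0) ^ n) has_sum F x y) UNIV"
    and sm: "(\<lambda>(m, n). a m n * r ^ m * r ^ n) summable_on UNIV"
    by (rule real_analytic2_onE[OF assms \<open>p \<in> S\<close>[unfolded p]], rule that)
  have "continuous_on (cball 0 r \<times> cball (0 :: real) r)
          (\<lambda>(w, z). \<Sum>\<^sub>\<infinity>(m, n). of_real (a m n) * w ^ m * z ^ n)"
    by (rule uniform_limit_theorem[OF _ double_power_series_uniform_limit[OF sm]])
       (auto simp: split_beta intro!: always_eventually continuous_intros)
  then have "continuous_on (cball x0 r \<times> cball y0 r)
     ((\<lambda>(w, z). \<Sum>\<^sub>\<infinity>(m, n). of_real (a m n) * w ^ m * z ^ n) \<circ> (\<lambda>(x, y). (x - x0, y - y0)))"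
    by (intro continuous_on_compose)
       (auto simp: split_beta dist_real_def abs_minus_commute intro!: continuous_intros
             elim!: continuous_on_subset)
  then have "continuous_on (cball x0 r \<times> cball y0 r) (\<lambda>(x, y). F x y)"
    by (rule continuous_on_eq) (use a in \<open>auto simp: split_beta infsumI\<close>)
  moreover have "p \<in> interior (cball x0 r \<times> cball y0 r)"
    using r p by (simp add: interior_Times)
  ultimately show "isCont (\<lambda>(x, y). F x y) p"
    by (rule continuous_on_interior)
qed

text \<open>Extend \<open>g\<close> and \<open>h\<close> to holomorphic \<open>G\<close> and
  \<open>H\<close> and substitute them into the double series of \<open>F\<close>. The partial sums
  are holomorphic and converge uniformly, so the limit is holomorphic; on the real axis it equals
  the composition.\<close>

lemma real_analytic_on_compose2:
  assumes F: "real_analytic2_on F S"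
    and g: "real_analytic_on g V" and h: "real_analytic_on h V"
    and maps: "\<And>x. x \<in> V \<Longrightarrow> (g x, h x) \<in> S"
  shows "real_analytic_on (\<lambda>x. F (g x) (h x)) V"
  unfolding real_analytic_on_iff_holomorphic
proof
  fix x0 assume x0: "x0 \<in> V"
  obtain r a where r: "r > 0"
    and a: "\<And>x y. x \<in> cball (g x0) r \<Longrightarrow> y \<in> cball (h x0) r \<Longrightarrow>
        ((\<lambda>(m, n). a m n * (x - g x0) ^ m * (y - h x0) ^ n) has_sum F x y) UNIV"
    and sm: "(\<lambda>(m, n). a m n * r ^ m * r ^ n) summable_on UNIV"
    by (rule real_analytic2_onE[OF F maps[OF x0]], rule that)
  let ?x0 = "complex_of_real x0"
  obtain \<rho>1 G where \<rho>1: "\<rho>1 > 0" and holG: "G holomorphic_on ball ?x0 \<rho>1"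
    and G: "\<And>x. x \<in> ball x0 \<rho>1 \<Longrightarrow> G (of_real x) = of_real (g x)"
    using g x0 unfolding real_analytic_on_iff_holomorphic by meson
  obtain \<rho>2 H where \<rho>2: "\<rho>2 > 0" and holH: "H holomorphic_on ball ?x0 \<rho>2"
    and H: "\<And>x. x \<in> ball x0 \<rho>2 \<Longrightarrow> H (of_real x) = of_real (h x)"
    using h x0 unfolding real_analytic_on_iff_holomorphic by meson
  have "isCont G ?x0" "isCont H ?x0"
    using holG holH \<rho>1 \<rho>2
    by (auto intro: continuous_on_interior holomorphic_on_imp_continuous_on)
  note cont = this[unfolded continuous_at_eps_delta, rule_format, OF r]
  obtain s1 where s1: "s1 > 0" "\<And>z. dist z ?x0 < s1 \<Longrightarrow> dist (G z) (G ?x0) < r"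
    using cont(1) by blast
  obtain s2 where s2: "s2 > 0" "\<And>z. dist z ?x0 < s2 \<Longrightarrow> dist (H z) (H ?x0) < r"
    using cont(2) by blast
  \<comment> \<open>The half makes \<open>s\<close> strictly smaller than all four radii: the closed
    disc lies where \<open>G\<close> and \<open>H\<close> are holomorphic, and their increments
    there stay in the polydisc of convergence.\<close>
  define s where "s = Min {\<rho>1, \<rho>2, s1, s2} / 2"
  have s: "s > 0" "s < \<rho>1" "s < \<rho>2" "s < s1" "s < s2"
    using \<rho>1 \<rho>2 s1(1) s2(1) by (auto simp: s_def min_def)
  define P where "P = (\<lambda>z. (G z - of_real (g x0), H z - of_real (h x0)))"
  have Px0: "G ?x0 = of_real (g x0)" "H ?x0 = of_real (h x0)"
    using G[of x0] H[of x0] \<rho>1 \<rho>2 by auto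
  have P: "P \<in> cball ?x0 s \<rightarrow> cball 0 r \<times> cball 0 r"
  proof
    fix z assume "z \<in> cball ?x0 s"
    then have "dist z ?x0 < s1" "dist z ?x0 < s2" using s by (auto simp: dist_commute)
    from s1(2)[OF this(1)] s2(2)[OF this(2)] show "P z \<in> cball 0 r \<times> cball 0 r"
      by (simp add: P_def Px0 dist_norm less_imp_le norm_minus_commute)
  qed
  define f where "f = (\<lambda>I z. \<Sum>(m, n)\<in>I.
      complex_of_real (a m n) * (G z - of_real (g x0)) ^ m * (H z - of_real (h x0)) ^ n)"
  define \<Phi> where "\<Phi> = (\<lambda>z. \<Sum>\<^sub>\<infinity>(m, n).
      complex_of_real (a m n) * (G z - of_real (g x0)) ^ m * (H z - of_real (h x0)) ^ n)"
  \<comment> \<open>Uniform convergence on the polydisc is pulled back along \<open>P\<close>, the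
    pair of increments of \<open>G\<close> and \<open>H\<close>.\<close>
  have ul: "uniform_limit (cball ?x0 s) f \<Phi> (finite_subsets_at_top UNIV)"
    using uniform_limit_compose'[OF double_power_series_uniform_limit[OF sm] P]
    by (simp add: P_def f_def \<Phi>_def)
  have "G holomorphic_on cball ?x0 s" "H holomorphic_on cball ?x0 s"
    using s by (auto intro: holomorphic_on_subset[OF holG] holomorphic_on_subset[OF holH])
  then have "f I holomorphic_on cball ?x0 s" for I
    unfolding f_def split_beta by (intro holomorphic_intros)
  then have "continuous_on (cball ?x0 s) (f I) \<and> f I holomorphic_on ball ?x0 s" for I
    using holomorphic_on_imp_continuous_on holomorphic_on_subset ball_subset_cball by blast
  then have hol: "\<Phi> holomorphic_on ball ?x0 s"
    using holomorphic_uniform_limit[OF _ ul] by (simp add: finite_subsets_at_top_neq_bot)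
  have "\<Phi> (of_real x) = of_real (F (g x) (h x))" if x: "x \<in> ball x0 s" for x
  proof -
    have Gx: "G (of_real x) = of_real (g x)" and Hx: "H (of_real x) = of_real (h x)"
      using G[of x] H[of x] x s by auto
    have "complex_of_real x \<in> cball ?x0 s"
      using x by (simp add: dist_real_def dist_norm flip: of_real_diff)
    then have "P (of_real x) \<in> cball 0 r \<times> cball 0 r" using P by blast
    then have "g x \<in> cball (g x0) r" "h x \<in> cball (h x0) r"
      by (simp_all add: P_def Gx Hx dist_real_def abs_minus_commute flip: of_real_diff)
    from has_sum_of_real[OF a[OF this], where 'a = complex]
    have "((\<lambda>(m, n). complex_of_real (a m n) * (G (of_real x) - of_real (g x0)) ^ m *
        (H (of_real x) - of_real (h x0)) ^ n) has_sum of_real (F (g x) (h x))) UNIV"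
      by (simp add: Gx Hx case_prod_unfold)
    then show ?thesis
      unfolding \<Phi>_def by (rule infsumI)
  qed
  then show "\<exists>\<rho>>0. \<exists>\<Phi>. \<Phi> holomorphic_on ball ?x0 \<rho> \<and>
      (\<forall>x\<in>ball x0 \<rho>. \<Phi> (of_real x) = of_real (F (g x) (h x)))"
    using hol s(1) by blast
qed

section \<open>Continuity, isolated zeros and the identity theorem in one variable\<close>

lemma real_analytic_on_ident: "real_analytic_on (\<lambda>x. x) S"
  unfolding real_analytic_on_iff_holomorphic
  by (intro ballI exI[of _ 1] conjI exI[of _ "\<lambda>z. z"]) auto

lemma real_analytic_on_imp_isCont:
  assumes "real_analytic_on f S" "x0 \<in> S"
  shows "isCont f x0"
proof -
  obtain \<rho> F where \<rho>: "\<rho> > 0" and hol: "F holomorphic_on ball (complex_of_real x0) \<rho>"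
      and F: "\<And>x. x\<in>ball x0 \<rho> \<Longrightarrow> F (complex_of_real x) = complex_of_real (f x)"
    using assms unfolding real_analytic_on_iff_holomorphic by meson
  have "of_real ` ball x0 \<rho> \<subseteq> ball (complex_of_real x0) \<rho>"
    by (auto simp: dist_real_def dist_norm simp flip: of_real_diff)
  then have "continuous_on (ball x0 \<rho>) (F \<circ> complex_of_real)"
    using continuous_on_subset[OF holomorphic_on_imp_continuous_on[OF hol]]
    by (intro continuous_on_compose continuous_on_of_real continuous_on_id) simp
  then have "continuous_on (ball x0 \<rho>) (\<lambda>x. Re (F (of_real x)))"
    by (simp add: continuous_on_Re o_def)
  then have "continuous_on (ball x0 \<rho>) f"
    by (rule continuous_on_eq) (simp add: F)
  then show ?thesis
    using \<rho> by (auto intro: continuous_on_interior)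
qed

text \<open>Isolated zeros: a nonzero Taylor coefficient would keep \<open>f\<close> away from 0 on
  a punctured neighbourhood of \<open>x0\<close>, so all coefficients vanish.\<close>

lemma real_analytic_on_frequently_zero:
  assumes "real_analytic_on f S" "x0 \<in> S" "\<exists>\<^sub>F x in at x0. f x = 0"
  shows "\<forall>\<^sub>F x in nhds x0. f x = 0"
proof -
  obtain \<rho> a where \<rho>: "\<rho> > 0"
    and a: "\<And>x. norm (x - x0) < \<rho> \<Longrightarrow> (\<lambda>n. a n * (x - x0) ^ n) sums f x"
    using assms(1,2) unfolding real_analytic_on_def
    by (metis dist_commute dist_norm mem_ball)
  \<comment> \<open>Continuity settles the constant coefficient; \<open>powser_0_nonzero\<close>
    then treats those of positive index, as it presupposes a zero at the centre.\<close>
  have f0: "f x0 = 0"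
  proof (rule ccontr)
    assume "f x0 \<noteq> 0"
    then have "\<forall>\<^sub>F x in at x0. f x \<noteq> 0"
      using real_analytic_on_imp_isCont[OF assms(1,2)]
      by (intro tendsto_imp_eventually_ne) (auto simp: isCont_def)
    then show False using assms(3) by (simp add: frequently_def)
  qed
  have "a m = 0" for m
  proof (cases "m = 0")
    case True
    have "(\<lambda>n. a n * 0 ^ n) sums 0" using a[of x0] \<rho> f0 by simp
    then show ?thesis using True powser_sums_zero_iff by metis
  next
    case False
    show ?thesis
    proof (rule ccontr)
      assume "a m \<noteq> 0"
      then obtain s where "0 < s" "\<And>z. z \<in> cball x0 s - {x0} \<Longrightarrow> f z \<noteq> 0"
        using powser_0_nonzero[OF \<rho> a f0] False by (metis gr0I)
      then have "\<forall>\<^sub>F x in at x0. f x \<noteq> 0"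
        unfolding eventually_at by (intro exI[of _ s]) (auto simp: dist_commute)
      then show False using assms(3) by (simp add: frequently_def)
    qed
  qed
  then have "f x = 0" if "norm (x - x0) < \<rho>" for x
    using a[OF that] by (simp add: sums_iff)
  then show ?thesis
    using \<rho> by (auto simp: eventually_nhds_metric dist_norm)
qed

text \<open>The set \<open>?Z\<close> of points near which \<open>f\<close> vanishes is open by
  definition, and its complement in \<open>S\<close> is open because zeros accumulating at a point
  would put that point in \<open>?Z\<close>. Connectedness leaves only one of the two sets.\<close>

lemma real_analytic_on_identity:
  assumes f: "real_analytic_on f S" and S: "open S" "connected S"
    and x0: "x0 \<in> S" "\<forall>\<^sub>F x in nhds x0. f x = 0" and "x \<in> S"
  shows "f x = 0"
proof -
  let ?Z = "{x. \<forall>\<^sub>F y in nhds x. f y = 0}"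
  have op: "open ?Z"
  proof (subst open_subopen, rule ballI)
    fix x assume "x \<in> ?Z"
    then obtain T where "open T" "x \<in> T" "\<And>y. y \<in> T \<Longrightarrow> f y = 0"
      unfolding eventually_nhds by auto
    then show "\<exists>T. open T \<and> x \<in> T \<and> T \<subseteq> ?Z"
      by (intro exI[of _ T]) (auto simp: eventually_nhds)
  qed
  have "open (S \<inter> - ?Z)"
  proof (subst open_subopen, rule ballI)
    fix x assume "x \<in> S \<inter> - ?Z"
    then have x: "x \<in> S" "\<not> (\<forall>\<^sub>F y in nhds x. f y = 0)" by auto
    then have "\<forall>\<^sub>F y in at x. f y \<noteq> 0"
      using real_analytic_on_frequently_zero[OF f] by (auto simp: frequently_def)
    then obtain U where U: "open U" "x \<in> U" "\<And>y. y \<in> U \<Longrightarrow> y \<noteq> x \<Longrightarrow> f y \<noteq> 0"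
      unfolding eventually_at_topological by auto
    have "y \<notin> ?Z" if "y \<in> U" for y
    proof (cases "y = x")
      case False
      then show ?thesis using U(3) that eventually_nhds_x_imp_x by blast
    qed (use x in simp)
    then show "\<exists>T. open T \<and> x \<in> T \<and> T \<subseteq> S \<inter> - ?Z"
      using U S(1) x by (intro exI[of _ "U \<inter> S"]) auto
  qed
  then have "?Z \<inter> S = {} \<or> (S \<inter> - ?Z) \<inter> S = {}"
    by (intro connectedD[OF S(2) op]) auto
  then have "x \<in> ?Z" using x0 \<open>x \<in> S\<close> by auto
  then show ?thesis by (auto dest: eventually_nhds_x_imp_x)
qed

text \<open>Read as a formal power series, the expansion has \<open>n\<close>-th derivative
  \<open>fact n * a n\<close> at 0, so every coefficient is zero.\<close>

lemma real_analytic_on_higher_deriv_zero: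
  assumes "real_analytic_on f S" "0 \<in> S" "\<And>n. (deriv ^^ n) f 0 = 0"
  shows "\<forall>\<^sub>F x in nhds 0. f x = 0"
proof -
  obtain \<rho> a where \<rho>: "\<rho> > 0"
    and a: "\<And>x. x \<in> ball 0 \<rho> \<Longrightarrow> (\<lambda>n. a n * x ^ n) sums f x"
    using assms(1,2) unfolding real_analytic_on_def by fastforce
  have ev: "\<forall>\<^sub>F x in nhds 0. x \<in> ball (0 :: real) \<rho>"
    using \<rho> by (intro eventually_nhds_in_open) auto
  have "f has_fps_expansion Abs_fps a"
    by (rule has_fps_expansionI, rule eventually_mono[OF ev]) (simp add: a)
  then have "(deriv ^^ n) f has_fps_expansion (fps_deriv ^^ n) (Abs_fps a)" for n
    by (induction n) (auto intro: has_fps_expansion_deriv)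
  from has_fps_expansion_imp_0_eq_fps_nth_0[OF this] have "a n = 0" for n
    using assms(3)[of n] by (simp add: fps_0th_higher_deriv)
  then have "f x = 0" if "x \<in> ball 0 \<rho>" for x
    using a[OF that] by (simp add: sums_iff)
  with ev show ?thesis by (auto elim: eventually_mono)
qed

section \<open>Sign of a function off its zero graph\<close>

text \<open>Each of the two sides of the graph of \<open>g\<close> is the image of a rectangle under
  \<open>(s, x) \<mapsto> ((1 - s) g(x) + s q, x)\<close> for an end point \<open>q\<close> of \<open>U\<close>, hence connected.\<close>

lemma positive_on_side_of_graph:
  fixes f :: "real \<Rightarrow> real \<Rightarrow> real" and q :: real
  assumes f: "continuous_on (ball c d \<times> V) (\<lambda>(m, x). f m x)"
    and g: "continuous_on V g" "g \<in> V \<rightarrow> ball c d" and V: "connected V"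
    and q: "q = c + d \<or> q = c - d"
    and nz: "\<And>m x. m \<in> ball c d \<Longrightarrow> x \<in> V \<Longrightarrow> f m x = 0 \<Longrightarrow> m = g x"
    and pos: "f m0 x0 > 0" "m0 \<in> open_segment (g x0) q" "x0 \<in> V"
    and m: "m \<in> open_segment (g x) q" "x \<in> V"
  shows "f m x > 0"
proof -
  let ?R = "{0<..<1::real} \<times> V"
  define P where "P = (\<lambda>(s, x). ((1 - s) * g x + s * q, x))"
  have P_in: "P z \<in> ball c d \<times> V \<and> fst (P z) \<noteq> g (snd (P z))" if z: "z \<in> ?R" for z
  proof -
    obtain s x where sx: "z = (s, x)" "0 < s" "s < 1" "x \<in> V" using z by auto
    have gx: "\<bar>g x - c\<bar> < d" using g(2) sx by (auto simp: dist_real_def abs_minus_commute)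
    have "(1 - s) * g x + s * q - c = (1 - s) * (g x - c) + s * (q - c)" by (simp add: algebra_simps)
    also have "\<bar>\<dots>\<bar> \<le> (1 - s) * \<bar>g x - c\<bar> + s * \<bar>q - c\<bar>"
      using sx by (intro abs_triangle_ineq[THEN order_trans]) (simp add: abs_mult)
    \<comment> \<open>Strictness comes from \<open>g x\<close>, which is interior and has positive
      weight \<open>1 - s\<close>; the end point \<open>q\<close> is at distance exactly
      \<open>d\<close> from \<open>c\<close>.\<close>
    also have "\<dots> < (1 - s) * d + s * d"
      using gx q sx by (intro add_less_le_mono mult_strict_left_mono mult_left_mono) auto
    finally have 1: "\<bar>(1 - s) * g x + s * q - c\<bar> < d" by (simp add: algebra_simps)
    have "(1 - s) * g x + s * q - g x = s * (q - g x)" by (simp add: algebra_simps)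
    moreover have "q \<noteq> g x" using gx q by auto
    ultimately have "(1 - s) * g x + s * q \<noteq> g x" using sx by auto
    with 1 sx show ?thesis by (simp add: P_def dist_real_def abs_minus_commute)
  qed
  have onto: "\<exists>z\<in>?R. P z = (m, x)" if "m \<in> open_segment (g x) q" "x \<in> V" for m x
    using that by (force simp: in_segment P_def)
  have "continuous_on ?R P"
    unfolding P_def split_beta
    by (intro continuous_intros continuous_on_compose2[OF g(1)]) auto
  moreover have "P ` ?R \<subseteq> ball c d \<times> V" using P_in by blast
  ultimately have "continuous_on ?R ((\<lambda>(m, x). f m x) \<circ> P)"
    using continuous_on_compose continuous_on_subset[OF f] by blast
  moreover have "connected ?R" using V by (intro connected_Times) auto
  ultimately have conn: "connected (((\<lambda>(m, x). f m x) \<circ> P) ` ?R)"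
    by (rule connected_continuous_image)
  have "f m0 x0 \<in> ((\<lambda>(m, x). f m x) \<circ> P) ` ?R" "f m x \<in> ((\<lambda>(m, x). f m x) \<circ> P) ` ?R"
    using onto pos m by (force simp: image_iff)+
  moreover have "0 \<notin> ((\<lambda>(m, x). f m x) \<circ> P) ` ?R"
    using P_in nz by (fastforce simp: image_iff split_beta)
  \<comment> \<open>The values of \<open>f\<close> on this side form a connected set of reals that
    contains a positive number and omits 0.\<close>
  ultimately show ?thesis
    using connectedD_interval[OF conn, of "f m x" "f m0 x0" 0] pos(1) by force
qed

text \<open>The bound says that on the axis \<open>f\<close> has slope \<open>k > 0\<close> at
  \<open>c\<close>. It provides one point with known sign on either side of the graph, and
  connectedness spreads each sign over its whole side.\<close>

lemma sign_relative_to_graph: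
  assumes f: "continuous_on (ball c d \<times> ball 0 e) (\<lambda>(m, x). f m x)"
    and graph: "zero_set_is_analytic_graph f (ball c d) (ball 0 e) g"
    and "d > 0" "e > 0" "k > 0"
    and bound: "\<forall>\<^sub>F \<delta> in nhds 0. \<bar>f (c + \<delta>) 0 - k * \<delta>\<bar> \<le> C * \<delta>\<^sup>2"
    and mx: "m \<in> ball c d" "x \<in> ball 0 e"
  shows "f m x > 0 \<longleftrightarrow> m > g x" "f m x < 0 \<longleftrightarrow> m < g x"
proof -
  have g: "continuous_on (ball 0 e) g" "g \<in> ball 0 e \<rightarrow> ball c d"
    using graph real_analytic_on_imp_isCont
    by (auto simp: zero_set_is_analytic_graph_def intro!: continuous_at_imp_continuous_on)
  have zero: "f m x = 0 \<longleftrightarrow> m = g x" if "m \<in> ball c d" "x \<in> ball 0 e" for m x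
    using graph that unfolding zero_set_is_analytic_graph_def set_eq_iff by auto
  \<comment> \<open>A property that holds eventually in \<open>nhds 0\<close> also holds at 0
    itself, where the bound is 0.\<close>
  have "f c 0 = 0"
    using eventually_nhds_x_imp_x[OF bound] by simp
  with zero[of c 0] \<open>d > 0\<close> \<open>e > 0\<close> have g0: "g 0 = c" by simp
  have "\<forall>\<^sub>F \<delta> in nhds 0. C * \<delta> < k \<and> \<delta> < d"
    using \<open>k > 0\<close> \<open>d > 0\<close>
    by (intro eventually_conj order_tendstoD(2)[of "\<lambda>\<delta>. C * \<delta>" 0] order_tendstoD(2)[of "\<lambda>\<delta>. \<delta>" 0])
       (auto intro!: tendsto_eq_intros filterlim_ident)
  with bound have "\<forall>\<^sub>F \<delta> in nhds 0. \<bar>f (c + \<delta>) 0 - k * \<delta>\<bar> \<le> C * \<delta>\<^sup>2 \<and> C * \<delta> < k \<and> \<delta> < d"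
    by eventually_elim simp
  then obtain r where r: "r > 0" and *: "\<And>\<delta>. \<bar>\<delta>\<bar> < r \<Longrightarrow>
      \<bar>f (c + \<delta>) 0 - k * \<delta>\<bar> \<le> C * \<delta>\<^sup>2 \<and> C * \<delta> < k \<and> \<delta> < d"
    unfolding eventually_nhds_metric by (auto simp: dist_real_def)
  \<comment> \<open>At this distance \<open>C * \<delta> < k\<close>, so the linear term beats the
    quadratic error at both \<open>c + \<delta>\<close> and \<open>c - \<delta>\<close>, and these
    points still lie inside the ball.\<close>
  define \<delta> where "\<delta> = r / 2"
  have \<delta>: "\<delta> > 0" "\<delta> < d" "C * \<delta> < k"
      "\<bar>f (c + \<delta>) 0 - k * \<delta>\<bar> \<le> C * \<delta>\<^sup>2" "\<bar>f (c - \<delta>) 0 + k * \<delta>\<bar> \<le> C * \<delta>\<^sup>2"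
    using r *[of \<delta>] *[of "- \<delta>"] by (simp_all add: \<delta>_def)
  have "C * \<delta>\<^sup>2 < k * \<delta>"
    using \<delta> by (simp add: power2_eq_square)
  with \<delta>(4,5) have pos: "f (c + \<delta>) 0 > 0" "- f (c - \<delta>) 0 > 0"
    by linarith+
  have seg: "c + \<delta> \<in> open_segment (g 0) (c + d)" "c - \<delta> \<in> open_segment (g 0) (c - d)"
    using \<delta>(1,2) by (auto simp: g0 open_segment_eq_real_ivl)
  have right: "f m x > 0" if "m > g x"
    by (rule positive_on_side_of_graph[OF f g _ _ _ pos(1) seg(1)])
       (use that mx zero \<open>e > 0\<close> in \<open>auto simp: open_segment_eq_real_ivl dist_real_def\<close>)
  \<comment> \<open>The left side is treated by the same lemma applied to the negative of
    \<open>f\<close>, which has the same zero graph.\<close>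
  have "continuous_on (ball c d \<times> ball 0 e) (\<lambda>(m, x). - f m x)"
    using continuous_on_minus[OF f] by (simp add: split_beta)
  then have left: "- f m x > 0" if "m < g x"
    by (rule positive_on_side_of_graph[where f = "\<lambda>m x. - f m x", OF _ g _ _ _ pos(2) seg(2)])
       (use that mx zero \<open>e > 0\<close> in \<open>auto simp: open_segment_eq_real_ivl dist_real_def\<close>)
  show "f m x > 0 \<longleftrightarrow> m > g x" "f m x < 0 \<longleftrightarrow> m < g x"
    using left right zero[OF mx] by (smt (verit))+
qed

text \<open>Each listed monomial carries a positive power of \<epsilon>, so restricting the bound to
  \<epsilon> = 0 makes it zero. Thus only the one-variable terms of the expansions survive on the
  axis.\<close>

lemma remainder2_axis_zero:
  assumes "remainder2 S ms r" "\<And>m n. (m, n) \<in> set ms \<Longrightarrow> n > 0"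
  shows "\<forall>\<^sub>F \<delta> in nhds 0. r \<delta> 0 = 0"
proof -
  obtain C where C: "\<forall>\<^sub>F (\<delta>, \<epsilon>) in nhds (0, 0).
        \<bar>r \<delta> \<epsilon>\<bar> \<le> C * (\<Sum>(m, n)\<leftarrow>ms. \<bar>\<delta>\<bar> ^ m * \<bar>\<epsilon>\<bar> ^ n)"
    using assms(1) by (auto simp: remainder2_def)
  have "filterlim (\<lambda>\<delta>::real. (\<delta>, 0::real)) (nhds (0, 0)) (nhds 0)"
    by (intro tendsto_intros) (simp add: filterlim_ident)
  from eventually_compose_filterlim[OF C this]
  have "\<forall>\<^sub>F \<delta> in nhds 0. \<bar>r \<delta> 0\<bar> \<le> C * (\<Sum>(m, n)\<leftarrow>ms. \<bar>\<delta>\<bar> ^ m * \<bar>0\<bar> ^ n)"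
    by simp
  moreover have "(\<Sum>(m, n)\<leftarrow>ms. \<bar>\<delta>\<bar> ^ m * \<bar>0\<bar> ^ n) = 0" for \<delta> :: real
  proof -
    have "(\<Sum>(m, n)\<leftarrow>ms. \<bar>\<delta>\<bar> ^ m * \<bar>0\<bar> ^ n) = (\<Sum>_\<leftarrow>ms. 0)"
      by (intro arg_cong[where f = sum_list] map_cong) (auto simp: power_0_left dest: assms(2))
    then show ?thesis by simp
  qed
  ultimately show ?thesis by simp
qed


section \<open>Eigenvalues of the matrix\<close>

lemma det_2_by_2:
  fixes A :: "'a :: comm_ring_1 mat"
  assumes A: "A \<in> carrier_mat 2 2"
  shows "det A = A $$ (0, 0) * A $$ (1, 1) - A $$ (0, 1) * A $$ (1, 0)"
proof -
  have "det (mat_delete A i 0) = A $$ (1 - i, 1)" if "i < 2" for i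
    using A that
    by (subst det_single) (auto simp: mat_delete_def less_2_cases_iff)
  then show ?thesis
    using laplace_expansion_column[OF A, of 0] A
    by (simp add: numeral_2_eq_2 cofactor_def algebra_simps)
qed

lemma L_mat_eq:
  "L_mat \<alpha> \<beta> \<gamma> \<mu> \<epsilon> = mat_of_rows_list 2
     [[- \<i> * of_real (\<alpha> \<mu> \<epsilon>), of_real (\<beta> \<mu> \<epsilon>)],
      [of_real (\<beta> \<mu> \<epsilon>), \<i> * of_real (\<gamma> \<mu> \<epsilon>)]]"
  by (rule eq_matI)
     (auto simp: L_mat_def J_mat_def B_mat_def mat_of_rows_list_def scalar_prod_def
        less_2_cases_iff numeral_2_eq_2 less_Suc_eq)

text \<open>Four times the characteristic polynomial is completed to a square, with
  \<open>D_fun\<close> as discriminant. This form serves both signs of the discriminant, without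
  choosing a square root.\<close>

lemma spectrum_L_mat_iff:
  "z \<in> spectrum (L_mat \<alpha> \<beta> \<gamma> \<mu> \<epsilon>) \<longleftrightarrow>
     (2 * z - \<i> * of_real (\<gamma> \<mu> \<epsilon> - \<alpha> \<mu> \<epsilon>))\<^sup>2 = of_real (D_fun \<alpha> \<beta> \<gamma> \<mu> \<epsilon>)"
proof -
  let ?L = "L_mat \<alpha> \<beta> \<gamma> \<mu> \<epsilon>"
  have L: "?L \<in> carrier_mat 2 2"
    by (rule carrier_matI) (simp_all add: L_mat_eq mat_of_rows_list_def)
  have "det (char_matrix ?L z) =
      (- \<i> * of_real (\<alpha> \<mu> \<epsilon>) - z) * (\<i> * of_real (\<gamma> \<mu> \<epsilon>) - z) - of_real (\<beta> \<mu> \<epsilon>) * of_real (\<beta> \<mu> \<epsilon>)"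
    by (subst det_2_by_2, use L in simp)
       (simp add: char_matrix_def L_mat_eq mat_of_rows_list_def)
  also have "4 * \<dots> =
      (2 * z - \<i> * of_real (\<gamma> \<mu> \<epsilon> - \<alpha> \<mu> \<epsilon>))\<^sup>2 - of_real (D_fun \<alpha> \<beta> \<gamma> \<mu> \<epsilon>)"
    by (simp add: D_fun_def T_fun_def power2_eq_square algebra_simps)
  finally have "4 * det (char_matrix ?L z) = \<dots>" .
  then have "det (char_matrix ?L z) = 0 \<longleftrightarrow>
      (2 * z - \<i> * of_real (\<gamma> \<mu> \<epsilon> - \<alpha> \<mu> \<epsilon>))\<^sup>2 = of_real (D_fun \<alpha> \<beta> \<gamma> \<mu> \<epsilon>)"
    by (metis eq_iff_diff_eq_0 mult_eq_0_iff zero_neq_numeral)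
  then show ?thesis
    by (simp add: spectrum_def eigenvalue_det[OF L])
qed

lemma Re_spectrum_L_mat_nonpos:
  assumes "D_fun \<alpha> \<beta> \<gamma> \<mu> \<epsilon> \<le> 0" "z \<in> spectrum (L_mat \<alpha> \<beta> \<gamma> \<mu> \<epsilon>)"
  shows "Re z = 0"
proof -
  define w where "w = 2 * z - \<i> * of_real (\<gamma> \<mu> \<epsilon> - \<alpha> \<mu> \<epsilon>)"
  have w: "w\<^sup>2 = of_real (D_fun \<alpha> \<beta> \<gamma> \<mu> \<epsilon>)"
    using assms(2) by (simp only: w_def spectrum_L_mat_iff)
  have "(Re w)\<^sup>2 - (Im w)\<^sup>2 \<le> 0" "Re w * Im w = 0"
    using arg_cong[OF w, of Re] arg_cong[OF w, of Im] assms(1) by (auto simp: power2_eq_square)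
  \<comment> \<open>If \<open>Re w\<close> were nonzero, the product would force
    \<open>Im w = 0\<close>, and then the square of \<open>Re w\<close> would be at most 0.\<close>
  then have "Re w = 0" by auto
  then show ?thesis by (simp add: w_def)
qed

lemma spectrum_L_mat_pos:
  assumes "D_fun \<alpha> \<beta> \<gamma> \<mu> \<epsilon> > 0"
  shows "\<exists>zp zm. spectrum (L_mat \<alpha> \<beta> \<gamma> \<mu> \<epsilon>) = {zp, zm} \<and> Re zp \<noteq> 0 \<and> Re zm = - Re zp"
proof -
  define s where "s = sqrt (D_fun \<alpha> \<beta> \<gamma> \<mu> \<epsilon>)"
  define c where "c = \<i> * of_real (\<gamma> \<mu> \<epsilon> - \<alpha> \<mu> \<epsilon>)"
  have s: "s > 0" "complex_of_real (D_fun \<alpha> \<beta> \<gamma> \<mu> \<epsilon>) = (of_real s)\<^sup>2"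
    using assms by (simp_all add: s_def flip: of_real_power)
  have "z \<in> spectrum (L_mat \<alpha> \<beta> \<gamma> \<mu> \<epsilon>) \<longleftrightarrow> z \<in> {(c + of_real s) / 2, (c - of_real s) / 2}" for z
  proof -
    have "z \<in> spectrum (L_mat \<alpha> \<beta> \<gamma> \<mu> \<epsilon>) \<longleftrightarrow> 2 * z - c = of_real s \<or> 2 * z - c = - of_real s"
      unfolding spectrum_L_mat_iff s(2) c_def[symmetric] by (rule power2_eq_iff)
    also have "\<dots> \<longleftrightarrow> z \<in> {(c + of_real s) / 2, (c - of_real s) / 2}"
      by (auto simp: field_simps)
    finally show ?thesis .
  qed
  then have "spectrum (L_mat \<alpha> \<beta> \<gamma> \<mu> \<epsilon>) = {(c + of_real s) / 2, (c - of_real s) / 2}"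
    by blast
  moreover have "Re ((c + of_real s) / 2) \<noteq> 0" "Re ((c - of_real s) / 2) = - Re ((c + of_real s) / 2)"
    using s(1) by (simp_all add: c_def)
  ultimately show ?thesis by blast
qed

lemma D_fun_eq: "D_fun \<alpha> \<beta> \<gamma> \<mu> \<epsilon> = - d_plus \<alpha> \<beta> \<gamma> \<mu> \<epsilon> * d_minus \<alpha> \<beta> \<gamma> \<mu> \<epsilon>"
  by (simp add: D_fun_def d_plus_def d_minus_def power2_eq_square algebra_simps)

section \<open>The instability criterion and the unstable region\<close>

theorem theorem2p5:
  fixes \<mu>u \<delta>0 \<epsilon>0 \<epsilon>1 \<omega> :: real
    and p :: int
    and \<alpha> \<beta> \<gamma> :: "real \<Rightarrow> real \<Rightarrow> real"
    and \<alpha>0 \<gamma>0 :: "real \<Rightarrow> real"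
    and \<alpha>1 \<alpha>2 \<beta>1 \<beta>2 \<beta>3 \<gamma>1 \<gamma>2 :: real
    and r\<alpha> r\<beta> r\<gamma> :: "real \<Rightarrow> real \<Rightarrow> real"
    and r\<alpha>0 r\<gamma>0 :: "real \<Rightarrow> real"
    and \<mu>0 \<mu>p \<mu>m :: "real \<Rightarrow> real"
  assumes "\<delta>0 > 0" and "\<epsilon>0 > 0"
    and "real_analytic2_on \<alpha> (ball \<mu>u \<delta>0 \<times> ball 0 \<epsilon>0)"
    and "real_analytic2_on \<beta> (ball \<mu>u \<delta>0 \<times> ball 0 \<epsilon>0)"
    and "real_analytic2_on \<gamma> (ball \<mu>u \<delta>0 \<times> ball 0 \<epsilon>0)"
    and "p \<ge> 2" and "\<omega> = ((of_int p)\<^sup>2 - 1) / 4"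
    and "remainder1 (ball 0 \<delta>0) [2] r\<alpha>0"
    and "\<And>\<delta>. \<delta> \<in> ball 0 \<delta>0 \<Longrightarrow> \<alpha>0 \<delta> = \<omega> - \<alpha>1 * \<delta> + r\<alpha>0 \<delta>"
    and "remainder1 (ball 0 \<delta>0) [2] r\<gamma>0"
    and "\<And>\<delta>. \<delta> \<in> ball 0 \<delta>0 \<Longrightarrow> \<gamma>0 \<delta> = \<omega> + \<gamma>1 * \<delta> + r\<gamma>0 \<delta>"
    and "\<alpha>1 + \<gamma>1 > 0"
    and "remainder2 (ball 0 \<delta>0 \<times> ball 0 \<epsilon>0) [(0, 3), (1, 2), (2, 1)] r\<alpha>"
    and "\<And>\<delta> \<epsilon>. \<delta> \<in> ball 0 \<delta>0 \<Longrightarrow> \<epsilon> \<in> ball 0 \<epsilon>0 \<Longrightarrow>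
           \<alpha> (\<mu>u + \<delta>) \<epsilon> = - \<alpha>0 \<delta> + \<alpha>2 * \<epsilon>\<^sup>2 + r\<alpha> \<delta> \<epsilon>"
    and "remainder2 (ball 0 \<delta>0 \<times> ball 0 \<epsilon>0) [(0, 5), (1, 3), (2, 2), (3, 1)] r\<beta>"
    and "\<And>\<delta> \<epsilon>. \<delta> \<in> ball 0 \<delta>0 \<Longrightarrow> \<epsilon> \<in> ball 0 \<epsilon>0 \<Longrightarrow>
           \<beta> (\<mu>u + \<delta>) \<epsilon> = \<beta>1 * \<epsilon>\<^sup>2 + \<beta>2 * \<delta> * \<epsilon>\<^sup>2 + \<beta>3 * \<epsilon> ^ 4 + r\<beta> \<delta> \<epsilon>"
    and "remainder2 (ball 0 \<delta>0 \<times> ball 0 \<epsilon>0) [(0, 3), (1, 2), (2, 1)] r\<gamma>"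
    and "\<And>\<delta> \<epsilon>. \<delta> \<in> ball 0 \<delta>0 \<Longrightarrow> \<epsilon> \<in> ball 0 \<epsilon>0 \<Longrightarrow>
           \<gamma> (\<mu>u + \<delta>) \<epsilon> = \<gamma>0 \<delta> + \<gamma>2 * \<epsilon>\<^sup>2 + r\<gamma> \<delta> \<epsilon>"
    and "0 < \<epsilon>1" and "\<epsilon>1 < \<epsilon>0"
    and "zero_set_is_analytic_graph (T_fun \<alpha> \<gamma>) (ball \<mu>u \<delta>0) (ball 0 \<epsilon>1) \<mu>0"
    and "zero_set_is_analytic_graph (d_plus \<alpha> \<beta> \<gamma>) (ball \<mu>u \<delta>0) (ball 0 \<epsilon>1) \<mu>p"
    and "zero_set_is_analytic_graph (d_minus \<alpha> \<beta> \<gamma>) (ball \<mu>u \<delta>0) (ball 0 \<epsilon>1) \<mu>m"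
  shows
    "(real_analytic_on (\<lambda>\<epsilon>. \<beta> (\<mu>0 \<epsilon>) \<epsilon>) (ball 0 \<epsilon>1) \<and>
      (\<forall>N. open N \<and> (\<mu>u, 0) \<in> N \<longrightarrow>
        ((\<exists>(\<mu>, \<epsilon>) \<in> N \<inter> (ball \<mu>u \<delta>0 \<times> ball 0 \<epsilon>1).
            \<exists>z \<in> spectrum (L_mat \<alpha> \<beta> \<gamma> \<mu> \<epsilon>). Re z \<noteq> 0)
         \<longleftrightarrow> \<not> (\<forall>\<epsilon> \<in> ball 0 \<epsilon>1. \<beta> (\<mu>0 \<epsilon>) \<epsilon> = 0))) \<and>
      (\<not> (\<forall>\<epsilon> \<in> ball 0 \<epsilon>1. \<beta> (\<mu>0 \<epsilon>) \<epsilon> = 0)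
         \<longleftrightarrow> (\<exists>n :: nat. (deriv ^^ n) (\<lambda>\<epsilon>. \<beta> (\<mu>0 \<epsilon>) \<epsilon>) 0 \<noteq> 0)))
     \<and>
     ((\<forall>\<mu> \<epsilon>. D_fun \<alpha> \<beta> \<gamma> \<mu> \<epsilon> = - d_plus \<alpha> \<beta> \<gamma> \<mu> \<epsilon> * d_minus \<alpha> \<beta> \<gamma> \<mu> \<epsilon>) \<and>
      R_region \<alpha> \<beta> \<gamma> (ball \<mu>u \<delta>0 \<times> ball 0 \<epsilon>1) =
        {(\<mu>, \<epsilon>) \<in> ball \<mu>u \<delta>0 \<times> ball 0 \<epsilon>1.
           min (\<mu>p \<epsilon>) (\<mu>m \<epsilon>) < \<mu> \<and> \<mu> < max (\<mu>p \<epsilon>) (\<mu>m \<epsilon>)} \<and>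
      (\<forall>(\<mu>, \<epsilon>) \<in> ball \<mu>u \<delta>0 \<times> ball 0 \<epsilon>1.
        ((\<exists>zp zm. spectrum (L_mat \<alpha> \<beta> \<gamma> \<mu> \<epsilon>) = {zp, zm} \<and> Re zp \<noteq> 0 \<and> Re zm = - Re zp)
           \<longleftrightarrow> (\<mu>, \<epsilon>) \<in> R_region \<alpha> \<beta> \<gamma> (ball \<mu>u \<delta>0 \<times> ball 0 \<epsilon>1)) \<and>
        ((\<mu>, \<epsilon>) \<notin> R_region \<alpha> \<beta> \<gamma> (ball \<mu>u \<delta>0 \<times> ball 0 \<epsilon>1) \<longrightarrow>
           (\<forall>z \<in> spectrum (L_mat \<alpha> \<beta> \<gamma> \<mu> \<epsilon>). Re z = 0))))"
proof -
  let ?U = "ball \<mu>u \<delta>0" and ?V = "ball (0 :: real) \<epsilon>1"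
  let ?b = "\<lambda>\<epsilon>. \<beta> (\<mu>0 \<epsilon>) \<epsilon>"
  note ana = assms(3-5) and graphs = assms(21-23)
  have V: "0 \<in> ?V" "open ?V" "connected ?V" "?V \<subseteq> ball 0 \<epsilon>0"
    using assms(19,20) by auto

  have cont: "continuous_on (?U \<times> ?V) (\<lambda>p. \<alpha> (fst p) (snd p))"
    "continuous_on (?U \<times> ?V) (\<lambda>p. \<beta> (fst p) (snd p))"
    "continuous_on (?U \<times> ?V) (\<lambda>p. \<gamma> (fst p) (snd p))"
    using ana[THEN real_analytic2_on_imp_continuous_on, THEN continuous_on_subset, of "?U \<times> ?V"] V(4)
    by (auto simp: case_prod_unfold)
  have cont_d: "continuous_on (?U \<times> ?V) (\<lambda>(m, x). d_plus \<alpha> \<beta> \<gamma> m x)"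
    "continuous_on (?U \<times> ?V) (\<lambda>(m, x). d_minus \<alpha> \<beta> \<gamma> m x)"
    unfolding d_plus_def d_minus_def T_fun_def case_prod_unfold
    by (intro continuous_intros cont)+

  obtain C1 where C1: "\<forall>\<^sub>F \<delta> in nhds 0. \<bar>r\<alpha>0 \<delta>\<bar> \<le> C1 * \<bar>\<delta>\<bar>\<^sup>2"
    using assms(8) by (auto simp: remainder1_def)
  obtain C2 where C2: "\<forall>\<^sub>F \<delta> in nhds 0. \<bar>r\<gamma>0 \<delta>\<bar> \<le> C2 * \<bar>\<delta>\<bar>\<^sup>2"
    using assms(10) by (auto simp: remainder1_def)
  have axis: "\<forall>\<^sub>F \<delta> in nhds 0. r\<alpha> \<delta> 0 = 0"
    by (rule remainder2_axis_zero[OF assms(13)], auto)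
  have axis': "\<forall>\<^sub>F \<delta> in nhds 0. r\<beta> \<delta> 0 = 0"
    by (rule remainder2_axis_zero[OF assms(15)], auto)
  have axis'': "\<forall>\<^sub>F \<delta> in nhds 0. r\<gamma> \<delta> 0 = 0"
    by (rule remainder2_axis_zero[OF assms(17)], auto)
  have dom: "\<forall>\<^sub>F \<delta> in nhds 0. \<delta> \<in> ball 0 \<delta>0"
    using assms(1) by (intro eventually_nhds_in_open) auto
  \<comment> \<open>In the sum of \<alpha> and \<gamma> the constant \<omega> cancels, leaving slope
    \<open>\<alpha>1 + \<gamma>1\<close> and a quadratic error. As \<beta> vanishes on the axis,
    \<open>d_plus\<close> and \<open>d_minus\<close> inherit the estimate from
    \<open>T_fun\<close>.\<close>
  have T0: "\<forall>\<^sub>F \<delta> in nhds 0. \<beta> (\<mu>u + \<delta>) 0 = 0 \<and>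
      \<bar>T_fun \<alpha> \<gamma> (\<mu>u + \<delta>) 0 - (\<alpha>1 + \<gamma>1) * \<delta>\<bar> \<le> (C1 + C2) * \<delta>\<^sup>2"
    using C1 C2 axis axis' axis'' dom
  proof eventually_elim
    case (elim \<delta>)
    note ball = elim(6) centre_in_ball[THEN iffD2, OF assms(2)]
    have "\<alpha> (\<mu>u + \<delta>) 0 = - (\<omega> - \<alpha>1 * \<delta> + r\<alpha>0 \<delta>)" "\<beta> (\<mu>u + \<delta>) 0 = 0"
      "\<gamma> (\<mu>u + \<delta>) 0 = \<omega> + \<gamma>1 * \<delta> + r\<gamma>0 \<delta>"
      using assms(14,16,18)[OF ball] assms(9,11)[OF ball(1)] elim(3-5) by simp_all
    moreover have "\<bar>r\<gamma>0 \<delta> - r\<alpha>0 \<delta>\<bar> \<le> (C1 + C2) * \<delta>\<^sup>2"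
      using elim(1,2) by (simp add: algebra_simps)
    ultimately show ?case
      by (simp add: T_fun_def algebra_simps)
  qed
  have "\<forall>\<^sub>F \<delta> in nhds 0.
      \<bar>d_plus \<alpha> \<beta> \<gamma> (\<mu>u + \<delta>) 0 - (\<alpha>1 + \<gamma>1) * \<delta>\<bar> \<le> (C1 + C2) * \<delta>\<^sup>2"
    using T0 by eventually_elim (simp add: d_plus_def)
  note sign_p = sign_relative_to_graph[OF cont_d(1) graphs(2) assms(1,19,12) this]
  have "\<forall>\<^sub>F \<delta> in nhds 0.
      \<bar>d_minus \<alpha> \<beta> \<gamma> (\<mu>u + \<delta>) 0 - (\<alpha>1 + \<gamma>1) * \<delta>\<bar> \<le> (C1 + C2) * \<delta>\<^sup>2"
    using T0 by eventually_elim (simp add: d_minus_def)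
  note sign_m = sign_relative_to_graph[OF cont_d(2) graphs(3) assms(1,19,12) this]

  \<comment> \<open>Positivity means that \<open>d_plus\<close> and \<open>d_minus\<close> have
    opposite signs, hence that \<open>m\<close> is to the right of one curve and to the left of the
    other.\<close>
  have D_pos: "D_fun \<alpha> \<beta> \<gamma> m x > 0 \<longleftrightarrow> min (\<mu>p x) (\<mu>m x) < m \<and> m < max (\<mu>p x) (\<mu>m x)"
    if "m \<in> ?U" "x \<in> ?V" for m x
  proof -
    have "D_fun \<alpha> \<beta> \<gamma> m x > 0 \<longleftrightarrow> d_plus \<alpha> \<beta> \<gamma> m x * d_minus \<alpha> \<beta> \<gamma> m x < 0"
      by (simp add: D_fun_eq)
    also have "\<dots> \<longleftrightarrow> m > \<mu>p x \<and> m < \<mu>m x \<or> m < \<mu>p x \<and> m > \<mu>m x"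
      unfolding mult_less_0_iff sign_p[OF that] sign_m[OF that] ..
    finally show ?thesis by auto
  qed
  have zero: "T_fun \<alpha> \<gamma> m x = 0 \<longleftrightarrow> m = \<mu>0 x" "d_plus \<alpha> \<beta> \<gamma> m x = 0 \<longleftrightarrow> m = \<mu>p x"
    "d_minus \<alpha> \<beta> \<gamma> m x = 0 \<longleftrightarrow> m = \<mu>m x" if "m \<in> ?U" "x \<in> ?V" for m x
    using graphs that unfolding zero_set_is_analytic_graph_def set_eq_iff by auto
  have \<mu>0: "real_analytic_on \<mu>0 ?V" "\<And>x. x \<in> ?V \<Longrightarrow> \<mu>0 x \<in> ?U"
    using graphs(1) by (auto simp: zero_set_is_analytic_graph_def)
  \<comment> \<open>The estimate at \<delta> = 0 makes the curve \<open>\<mu>0\<close> pass through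
    the point \<open>(\<mu>u, 0)\<close>, so it meets each neighbourhood of that point.\<close>
  have "T_fun \<alpha> \<gamma> \<mu>u 0 = 0"
    using eventually_nhds_x_imp_x[OF T0] by simp
  then have \<mu>0_0: "\<mu>0 0 = \<mu>u"
    using zero(1)[of \<mu>u 0] V(1) assms(1) by simp

  have b_ana: "real_analytic_on ?b ?V"
    using \<mu>0 V(4) by (intro real_analytic_on_compose2[OF ana(2)] real_analytic_on_ident) auto
  have b_zero: "\<forall>x\<in>?V. ?b x = 0" if "\<forall>\<^sub>F x in nhds 0. ?b x = 0"
    using real_analytic_on_identity[OF b_ana V(2,3,1) that] by blast

  have b_deriv: "\<not> (\<forall>\<epsilon>\<in>?V. ?b \<epsilon> = 0) \<longleftrightarrow> (\<exists>n. (deriv ^^ n) ?b 0 \<noteq> 0)"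
  proof -
    have "(deriv ^^ n) ?b 0 = 0" if "\<forall>\<epsilon>\<in>?V. ?b \<epsilon> = 0" for n
    proof -
      \<comment> \<open>Nothing is known about the values off \<open>?V\<close>; agreement with the
        zero function near 0 determines all derivatives there.\<close>
      have "\<forall>\<^sub>F x in nhds 0. ?b x = 0"
        using V(1,2) that eventually_nhds by blast
      then have "(deriv ^^ n) ?b 0 = (deriv ^^ n) (\<lambda>_. 0 :: real) 0"
        by (intro higher_deriv_cong_ev) auto
      also have "(deriv ^^ n) (\<lambda>_. 0 :: real) = (\<lambda>_. 0)"
        by (induction n) auto
      finally show ?thesis .
    qed
    moreover have "\<forall>\<epsilon>\<in>?V. ?b \<epsilon> = 0" if "\<And>n. (deriv ^^ n) ?b 0 = 0"
      using real_analytic_on_higher_deriv_zero[OF b_ana V(1) that] by (rule b_zero)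
    ultimately show ?thesis by blast
  qed

  have unstable_iff: "(\<exists>z \<in> spectrum (L_mat \<alpha> \<beta> \<gamma> m x). Re z \<noteq> 0) \<longleftrightarrow> D_fun \<alpha> \<beta> \<gamma> m x > 0" for m x
  proof
    assume "D_fun \<alpha> \<beta> \<gamma> m x > 0"
    from spectrum_L_mat_pos[OF this] show "\<exists>z \<in> spectrum (L_mat \<alpha> \<beta> \<gamma> m x). Re z \<noteq> 0"
      by auto
  qed (use Re_spectrum_L_mat_nonpos in force)

  have part1: "(\<exists>(m, x) \<in> N \<inter> (?U \<times> ?V). \<exists>z \<in> spectrum (L_mat \<alpha> \<beta> \<gamma> m x). Re z \<noteq> 0)
      \<longleftrightarrow> \<not> (\<forall>x\<in>?V. ?b x = 0)" if N: "open N" "(\<mu>u, 0) \<in> N" for N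
  proof
    assume "\<exists>(m, x) \<in> N \<inter> (?U \<times> ?V). \<exists>z \<in> spectrum (L_mat \<alpha> \<beta> \<gamma> m x). Re z \<noteq> 0"
    then obtain m x where mx: "m \<in> ?U" "x \<in> ?V" and D: "D_fun \<alpha> \<beta> \<gamma> m x > 0"
      by (auto simp: unstable_iff)
    show "\<not> (\<forall>x\<in>?V. ?b x = 0)"
    proof
      assume "\<forall>x\<in>?V. ?b x = 0"
      \<comment> \<open>Where both \<open>T_fun\<close> and \<beta> vanish, so do
        \<open>d_plus\<close> and \<open>d_minus\<close>: the two bounding curves meet at
        \<open>\<mu>0 x\<close> and no room is left between them.\<close>
      then have "d_plus \<alpha> \<beta> \<gamma> (\<mu>0 x) x = 0" "d_minus \<alpha> \<beta> \<gamma> (\<mu>0 x) x = 0"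
        using zero(1)[OF \<mu>0(2)[OF mx(2)] mx(2)] mx(2) by (simp_all add: d_plus_def d_minus_def)
      then have "\<mu>p x = \<mu>0 x" "\<mu>m x = \<mu>0 x"
        using zero(2,3)[OF \<mu>0(2)[OF mx(2)] mx(2)] by simp_all
      then show False using D D_pos[OF mx] by auto
    qed
  next
    assume nz: "\<not> (\<forall>x\<in>?V. ?b x = 0)"
    have "((\<lambda>x. (\<mu>0 x, x)) \<longlongrightarrow> (\<mu>0 0, 0)) (nhds 0)"
      using real_analytic_on_imp_isCont[OF \<mu>0(1) V(1)]
      by (intro tendsto_Pair) (auto simp: filterlim_ident isCont_def tendsto_at_iff_tendsto_nhds)
    then have "\<forall>\<^sub>F x in nhds 0. (\<mu>0 x, x) \<in> N"
      using N unfolding \<mu>0_0 by (rule topological_tendstoD)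
    moreover have "\<forall>\<^sub>F x in nhds 0. x \<in> ?V"
      using V(1,2) by (intro eventually_nhds_in_open)
    ultimately have ev: "\<forall>\<^sub>F x in nhds 0. (\<mu>0 x, x) \<in> N \<and> x \<in> ?V"
      by (rule eventually_conj)
    \<comment> \<open>Otherwise \<open>?b\<close> would vanish near 0, hence on all of
      \<open>?V\<close>. At the point obtained \<open>T_fun\<close> is 0, so the discriminant is
      four times the square of a nonzero number.\<close>
    obtain x where x: "?b x \<noteq> 0" "x \<in> ?V" "(\<mu>0 x, x) \<in> N"
      using b_zero[OF eventually_mono[OF ev]] nz by auto
    then have "D_fun \<alpha> \<beta> \<gamma> (\<mu>0 x) x > 0"
      using zero(1)[OF \<mu>0(2)[OF x(2)] x(2)] by (simp add: D_fun_def)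
    then show "\<exists>(m, x) \<in> N \<inter> (?U \<times> ?V). \<exists>z \<in> spectrum (L_mat \<alpha> \<beta> \<gamma> m x). Re z \<noteq> 0"
      using x \<mu>0(2)[OF x(2)] unfolding unstable_iff by blast
  qed

  have R_eq: "R_region \<alpha> \<beta> \<gamma> (?U \<times> ?V) =
      {(m, x) \<in> ?U \<times> ?V. min (\<mu>p x) (\<mu>m x) < m \<and> m < max (\<mu>p x) (\<mu>m x)}"
    using D_pos by (auto simp only: R_region_def mem_Sigma_iff mem_Collect_eq case_prod_conv)
  have part2: "((\<exists>zp zm. spectrum (L_mat \<alpha> \<beta> \<gamma> m x) = {zp, zm} \<and> Re zp \<noteq> 0 \<and> Re zm = - Re zp)
           \<longleftrightarrow> (m, x) \<in> R_region \<alpha> \<beta> \<gamma> (?U \<times> ?V)) \<and>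
        ((m, x) \<notin> R_region \<alpha> \<beta> \<gamma> (?U \<times> ?V) \<longrightarrow>
           (\<forall>z \<in> spectrum (L_mat \<alpha> \<beta> \<gamma> m x). Re z = 0))" if "(m, x) \<in> ?U \<times> ?V" for m x
  proof -
    have R: "(m, x) \<in> R_region \<alpha> \<beta> \<gamma> (?U \<times> ?V) \<longleftrightarrow> D_fun \<alpha> \<beta> \<gamma> m x > 0"
      using that by (simp add: R_region_def)
    \<comment> \<open>The eigenvalue \<open>zp\<close> lies off the imaginary axis, which by
      \<open>unstable_iff\<close> forces a positive discriminant.\<close>
    have "D_fun \<alpha> \<beta> \<gamma> m x > 0" if "spectrum (L_mat \<alpha> \<beta> \<gamma> m x) = {zp, zm}" "Re zp \<noteq> 0" for zp zm
      using unstable_iff[of m x] that by simp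
    then show ?thesis
      unfolding R using spectrum_L_mat_pos[of \<alpha> \<beta> \<gamma> m x] unstable_iff[of m x] by blast
  qed

  show ?thesis
    using b_ana part1 b_deriv D_fun_eq R_eq part2 by (intro conjI allI impI) auto
qed

end
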